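(* For every integer $r\geq 2$, \[ R_r(4)\leq \frac{(2r)!}{2^r}\left(\frac{10}{3}-\frac{2(r-2)}{(2r-1)(2r-3)}\right), \] and, asymptotically as $r\to\infty$, \[ R_r(4)\leq \frac{(2r)!}{2^r}\left(\frac{3+e}{2}\right)(1+o(1)). \]
   Context: For integers $r\geq 1$ and $k_1,\dots,k_r\geq 1$, the Ramsey number $R_r(k_1,\dots,k_r)$ is the minimum $N\in\mathbb{N}$ such that every coloring of the edges of the complete graph $K_N$ with $r$ colors $1,\dots,r$ contains, for some $i$, a complete subgraph on $k_i$ vertices all of whose edges have color $i$. The diagonal Ramsey number is $R_r(k)=R_r(k,\dots,k)$. Here $o(1)$ denotes a function tending to $0$ as $r\to\infty$. *)

theory Defs
  imports Complex_Main "HOL-Library.Ramsey"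
begin

text \<open>
  The list \<open>ks\<close> is \<open>[k\<^sub>1, \<dots>, k\<^sub>r]\<close>; its length is the number of colours, and the
  colours are numbered from 0. An edge of the complete graph on \<open>{..<N}\<close> is a
  2-element set of vertices.
\<close>
definition ramsey_number :: "nat list \<Rightarrow> nat" where
  "ramsey_number ks = (LEAST N. partn_lst {..<N} ks 2)"

lemma partn_lst_ramsey_number: "partn_lst {..<ramsey_number ks} ks 2"
  unfolding ramsey_number_def using ramsey_full[of ks 2] by (rule LeastI_ex)

definition diagonal_ramsey :: "nat \<Rightarrow> nat \<Rightarrow> nat" where
  "diagonal_ramsey r k = ramsey_number (replicate r k)"

end

theory Submission
  imports Defs
begin

text \<open>
  In the colour-\<open>c\<close> neighbourhood of a vertex the forbidden clique size for \<open>c\<close> drops by one.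
  Hence the largest number \<open>g s t\<close> of vertices for which \<open>s\<close> colours can avoid \<open>K\<^sub>4\<close> and \<open>t\<close>
  further colours can avoid \<open>K\<^sub>3\<close> satisfies \<open>g s t \<le> 1 + s g (s-1) (t+1) + t g s (t-1)\<close>.
  With \<open>n = 2s + t\<close>, the homogeneous recursion is solved by \<open>n!/2\<^sup>s\<close> and \<open>s(n-2)!/2\<^sup>s\<close>, and
  \<open>-(n-2)!/2\<^sup>s\<close> exceeds its own recursion by \<open>2(n-3)!/2\<^sup>s\<close>, which pays for the term 1 once
  \<open>n \<ge> 5\<close>. A combination of the three that dominates \<open>g\<close> for \<open>n = 4\<close> therefore dominates it
  for all \<open>n \<ge> 4\<close>; its leading coefficient \<open>67/24\<close> is already smaller than \<open>(3 + e)/2\<close>.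
\<close>

definition clique_avoiding :: "'c set \<Rightarrow> ('c \<Rightarrow> nat) \<Rightarrow> 'a set \<Rightarrow> ('a set \<Rightarrow> 'c) \<Rightarrow> bool" where
  "clique_avoiding C k V f \<longleftrightarrow>
     f \<in> nsets V 2 \<rightarrow> C \<and> (\<forall>c\<in>C. \<not> monochromatic V (k c) 2 f c)"

definition colour_neighbours :: "('a set \<Rightarrow> 'c) \<Rightarrow> 'a set \<Rightarrow> 'a \<Rightarrow> 'c \<Rightarrow> 'a set" where
  "colour_neighbours f V v c = {w \<in> V - {v}. f {v, w} = c}"

lemma monochromatic_mono: "monochromatic W k n f c \<Longrightarrow> W \<subseteq> V \<Longrightarrow> monochromatic V k n f c"
  unfolding monochromatic_def by (meson nsets_mono subsetD)

lemma monochromatic_insert_vertex: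
  assumes "monochromatic (colour_neighbours f V v c) k 2 f c" and "v \<in> V"
  shows "monochromatic V (Suc k) 2 f c"
proof -
  obtain H where H: "H \<in> nsets (colour_neighbours f V v c) k" and H_mono: "f ` nsets H 2 \<subseteq> {c}"
    using assms(1) unfolding monochromatic_def by blast
  have "insert v H \<in> nsets V (Suc k)"
    using H \<open>v \<in> V\<close> by (auto simp: nsets_def colour_neighbours_def card_insert_if)
  moreover have "f e = c" if e: "e \<in> nsets (insert v H) 2" for e
  proof (cases "v \<in> e")
    case True
    with e obtain w where "w \<in> H" "e = {v, w}"
      by (auto elim!: nsets2_E)
    then show ?thesis
      using H by (auto simp: nsets_def colour_neighbours_def)
  next
    case False
    with e have "e \<in> nsets H 2"
      by (auto simp: nsets_def)
    then show ?thesis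
      using H_mono by auto
  qed
  ultimately show ?thesis
    unfolding monochromatic_def by blast
qed

lemma clique_avoiding_colour_neighbours:
  assumes "clique_avoiding C k V f" and "v \<in> V" and "c \<in> C" and "k c = Suc j"
  shows "clique_avoiding C (k(c := j)) (colour_neighbours f V v c) f"
proof -
  have "colour_neighbours f V v c \<subseteq> V"
    by (auto simp: colour_neighbours_def)
  then show ?thesis
    using assms monochromatic_insert_vertex[of f V v c j]
    unfolding clique_avoiding_def
    by (auto dest: nsets_Pi_contra[THEN subsetD] monochromatic_mono[of _ _ _ _ _ V])
qed

lemma clique_avoiding_1_imp_empty:
  assumes "clique_avoiding C k V f" and "c \<in> C" and "k c = 1"
  shows "V = {}"
  using assms by (auto simp: clique_avoiding_def monochromatic_def nsets_one nsets_singleton_iff)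

lemma card_eq_Suc_sum_colour_neighbours:
  assumes "finite V" "finite C" "v \<in> V" and "f \<in> nsets V 2 \<rightarrow> C"
  shows "card V = Suc (\<Sum>c\<in>C. card (colour_neighbours f V v c))"
proof -
  have "V - {v} = (\<Union>c\<in>C. colour_neighbours f V v c)"
    using assms(3,4) by (auto simp: colour_neighbours_def Pi_iff)
  moreover have "card (\<Union>c\<in>C. colour_neighbours f V v c)
      = (\<Sum>c\<in>C. card (colour_neighbours f V v c))"
    using assms(1,2) by (intro card_UN_disjoint) (auto simp: colour_neighbours_def)
  ultimately show ?thesis
    using card.remove[OF assms(1,3)] by simp
qed

lemma clique_avoiding_card_le_Suc_sum:
  assumes avoiding: "clique_avoiding C k V f" and "finite V" "finite C"
    and bound: "\<And>c j W. \<lbrakk>c \<in> C; k c = Suc j; finite W; clique_avoiding C (k(c := j)) W f\<rbrakk>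
      \<Longrightarrow> card W \<le> b c"
  shows "card V \<le> Suc (\<Sum>c\<in>C. b c)"
proof (cases "V = {}")
  case False
  then obtain v where "v \<in> V"
    by blast
  have "card (colour_neighbours f V v c) \<le> b c" if "c \<in> C" for c
  proof -
    have "monochromatic V 0 2 f c"
      by (simp add: monochromatic_def nsets_empty_iff)
    then have "k c \<noteq> 0"
      using avoiding that unfolding clique_avoiding_def by metis
    then obtain j where "k c = Suc j"
      using not0_implies_Suc by blast
    moreover have "finite (colour_neighbours f V v c)"
      using \<open>finite V\<close> by (simp add: colour_neighbours_def)
    ultimately show ?thesis
      using that clique_avoiding_colour_neighbours[OF avoiding \<open>v \<in> V\<close>] by (intro bound) auto
  qed
  then have "(\<Sum>c\<in>C. card (colour_neighbours f V v c)) \<le> (\<Sum>c\<in>C. b c)"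
    by (rule sum_mono)
  moreover have "f \<in> nsets V 2 \<rightarrow> C"
    using avoiding by (simp add: clique_avoiding_def)
  ultimately show ?thesis
    using card_eq_Suc_sum_colour_neighbours[OF \<open>finite V\<close> \<open>finite C\<close> \<open>v \<in> V\<close>] by simp
qed simp

lemma ramsey_number_le:
  assumes "\<And>f. \<not> clique_avoiding {..<length ks} (\<lambda>i. ks ! i) {..<N} f"
  shows "ramsey_number ks \<le> N"
proof -
  have "partn_lst {..<N} ks 2"
    using assms by (auto simp: partn_lst_def clique_avoiding_def)
  then show ?thesis
    unfolding ramsey_number_def by (rule Least_le)
qed

function K4_K3_bound :: "nat \<Rightarrow> nat \<Rightarrow> nat" where
  "K4_K3_bound s t = 1 + (if s = 0 then 0 else s * K4_K3_bound (s - 1) (Suc t))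
                       + (if t = 0 then 0 else t * K4_K3_bound s (t - 1))"
  by auto
termination by (relation "measure (\<lambda>(s, t). 2 * s + t)") auto

declare K4_K3_bound.simps [simp del]

definition K4_K3_step :: "(nat \<Rightarrow> nat \<Rightarrow> 'a::semiring_1) \<Rightarrow> nat \<Rightarrow> nat \<Rightarrow> 'a" where
  "K4_K3_step g s t = of_nat s * g (s - 1) (Suc t) + of_nat t * g s (t - 1)"

lemma K4_K3_bound_rec: "K4_K3_bound s t = 1 + K4_K3_step K4_K3_bound s t"
  by (subst K4_K3_bound.simps) (simp add: K4_K3_step_def)

lemma K4_K3_step_mono:
  fixes g h :: "nat \<Rightarrow> nat \<Rightarrow> 'a::linordered_semidom"
  assumes "\<And>s' t'. 2 * s' + t' + 1 = 2 * s + t \<Longrightarrow> g s' t' \<le> h s' t'"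
  shows "K4_K3_step g s t \<le> K4_K3_step h s t"
proof -
  have "of_nat s * g (s - 1) (Suc t) \<le> of_nat s * h (s - 1) (Suc t)"
    using assms[of "s - 1" "Suc t"] by (cases s) (auto intro: mult_left_mono)
  moreover have "of_nat t * g s (t - 1) \<le> of_nat t * h s (t - 1)"
    using assms[of s "t - 1"] by (cases t) (auto intro: mult_left_mono)
  ultimately show ?thesis
    unfolding K4_K3_step_def by (rule add_mono)
qed

definition clique_sizes_bound :: "'c set \<Rightarrow> ('c \<Rightarrow> nat) \<Rightarrow> nat" where
  "clique_sizes_bound C k = K4_K3_bound (card {c\<in>C. k c = 4}) (card {c\<in>C. k c = 3})"

lemma clique_sizes_bound_rec:
  assumes "finite C"
  shows "clique_sizes_bound C k
    = Suc (\<Sum>c\<in>C. if k c \<in> {3, 4} then clique_sizes_bound C (k(c := k c - 1)) else 0)"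
    (is "_ = Suc (\<Sum>c\<in>C. ?b c)")
proof -
  let ?A = "{c\<in>C. k c = 4}" and ?B = "{c\<in>C. k c = 3}"
  have b_A: "?b c = K4_K3_bound (card ?A - 1) (Suc (card ?B))" if "c \<in> ?A" for c
  proof -
    have "{x\<in>C. (k(c := 3)) x = 4} = ?A - {c}" "{x\<in>C. (k(c := 3)) x = 3} = insert c ?B"
      using that by auto
    then show ?thesis
      using that assms by (simp add: clique_sizes_bound_def)
  qed
  have b_B: "?b c = K4_K3_bound (card ?A) (card ?B - 1)" if "c \<in> ?B" for c
  proof -
    have "{x\<in>C. (k(c := 2)) x = 4} = ?A" "{x\<in>C. (k(c := 2)) x = 3} = ?B - {c}"
      using that by auto
    then show ?thesis
      using that assms by (simp add: clique_sizes_bound_def)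
  qed
  have "(\<Sum>c\<in>C. ?b c) = (\<Sum>c\<in>?A \<union> ?B. ?b c)"
    using assms by (intro sum.mono_neutral_right) auto
  also have "\<dots> = (\<Sum>c\<in>?A. ?b c) + (\<Sum>c\<in>?B. ?b c)"
    using assms by (intro sum.union_disjoint) auto
  also have "\<dots> = (\<Sum>c\<in>?A. K4_K3_bound (card ?A - 1) (Suc (card ?B)))
      + (\<Sum>c\<in>?B. K4_K3_bound (card ?A) (card ?B - 1))"
    by (intro arg_cong2[where f = "(+)"] sum.cong refl b_A b_B)
  also have "\<dots> = K4_K3_step K4_K3_bound (card ?A) (card ?B)"
    by (simp add: K4_K3_step_def)
  finally show ?thesis
    unfolding clique_sizes_bound_def[of C k] K4_K3_bound_rec[of "card ?A"] by simp
qed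

text \<open>Size 2 stands for a colour that no longer occurs, so that \<open>C\<close> stays fixed in the induction.\<close>
lemma card_le_clique_sizes_bound:
  assumes "clique_avoiding C k V f" "finite V" "finite C" and "k \<in> C \<rightarrow> {2, 3, 4}"
  shows "card V \<le> clique_sizes_bound C k"
  using assms
proof (induction "sum k C" arbitrary: k V rule: less_induct)
  case less
  have "card V
      \<le> Suc (\<Sum>c\<in>C. if k c \<in> {3, 4} then clique_sizes_bound C (k(c := k c - 1)) else 0)"
    using less.prems(1-3)
  proof (rule clique_avoiding_card_le_Suc_sum)
    fix c j W
    assume c: "c \<in> C" "k c = Suc j" and W: "finite W" "clique_avoiding C (k(c := j)) W f"
    show "card W \<le> (if k c \<in> {3, 4} then clique_sizes_bound C (k(c := k c - 1)) else 0)"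
    proof (cases "k c \<in> {3, 4}")
      case True
      have "card W \<le> clique_sizes_bound C (k(c := j))"
      proof (rule less.hyps)
        show "sum (k(c := j)) C < sum k C"
          using c \<open>finite C\<close> by (intro sum_strict_mono_ex1) auto
        show "k(c := j) \<in> C \<rightarrow> {2, 3, 4}"
          using less.prems(4) c True by (auto simp: Pi_iff)
      qed (fact W \<open>finite C\<close>)+
      then show ?thesis
        using True c by simp
    next
      case False
      then have "j = 1"
        using less.prems(4) c by (auto simp: Pi_iff)
      then show ?thesis
        using clique_avoiding_1_imp_empty[OF W(2) c(1)] by simp
    qed
  qed
  then show ?case
    by (simp only: clique_sizes_bound_rec[OF \<open>finite C\<close>, of k])
qed

lemma diagonal_ramsey_4_le_K4_K3_bound: "diagonal_ramsey r 4 \<le> Suc (K4_K3_bound r 0)"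
  unfolding diagonal_ramsey_def
proof (rule ramsey_number_le, rule notI)
  fix f :: "nat set \<Rightarrow> nat"
  assume "clique_avoiding {..<length (replicate r 4)} (\<lambda>i. replicate r 4 ! i)
    {..<Suc (K4_K3_bound r 0)} f"
  then have "clique_avoiding {..<r} (\<lambda>_. 4) {..<Suc (K4_K3_bound r 0)} f"
    by (simp add: clique_avoiding_def)
  from card_le_clique_sizes_bound[OF this] show False
    by (simp add: clique_sizes_bound_def)
qed

lemma K4_K3_step_affine:
  fixes a b :: "nat \<Rightarrow> real"
  assumes "2 * s + t = Suc m"
  shows "K4_K3_step (\<lambda>s t. (a (2 * s + t) + real s * b (2 * s + t)) / 2 ^ s) s t
       = (real (Suc m) * a m + real s * (real m - 1) * b m) / 2 ^ s"
proof -
  have s_part: "real s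
        * ((a (2 * (s - 1) + Suc t) + real (s - 1) * b (2 * (s - 1) + Suc t)) / 2 ^ (s - 1))
      = 2 * real s * (a m + (real s - 1) * b m) / 2 ^ s"
    using assms by (cases s) (auto simp: field_simps)
  have t_part: "real t * ((a (2 * s + (t - 1)) + real s * b (2 * s + (t - 1))) / 2 ^ s)
      = real t * (a m + real s * b m) / 2 ^ s"
    using assms by (cases t) auto
  have "K4_K3_step (\<lambda>s t. (a (2 * s + t) + real s * b (2 * s + t)) / 2 ^ s) s t
      = 2 * real s * (a m + (real s - 1) * b m) / 2 ^ s + real t * (a m + real s * b m) / 2 ^ s"
    unfolding K4_K3_step_def s_part t_part ..
  also have "\<dots> = ((2 * real s + real t) * a m + real s * (2 * real s + real t - 2) * b m) / 2 ^ s"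
    by (simp add: field_simps)
  also have "2 * real s + real t = real (Suc m)"
    using assms by simp
  finally show ?thesis by simp
qed

lemma two_power_le_two_mult_fact: "2 ^ m \<le> (2 * fact m :: 'a::linordered_semidom)"
proof (induction m)
  case (Suc m)
  show ?case
  proof (cases m)
    case (Suc j)
    then have "2 \<le> (of_nat (Suc m) :: 'a)"
      using of_nat_mono[of 2 "Suc m", where 'a = 'a] by simp
    then have "2 * 2 ^ m \<le> of_nat (Suc m) * (2 * fact m :: 'a)"
      using Suc.IH by (intro mult_mono) auto
    then show ?thesis by (simp add: algebra_simps)
  qed simp
qed simp

text \<open>The coefficients make the bound exact at \<open>(0, 4)\<close> and \<open>(2, 0)\<close>.\<close>
definition K4_K3_majorant :: "nat \<Rightarrow> nat \<Rightarrow> real" where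
  "K4_K3_majorant s t =
     (67/24 * fact (2 * s + t) - fact (2 * s + t - 2)
      + real s * (11/4 * fact (2 * s + t - 2))) / 2 ^ s"

lemma K4_K3_majorant_step_le:
  assumes "5 \<le> 2 * s + t"
  shows "1 + K4_K3_step K4_K3_majorant s t \<le> K4_K3_majorant s t"
proof -
  obtain m where n: "2 * s + t = m + 3" and "s \<le> m"
    using assms that[of "2 * s + t - 3"] by auto
  let ?a = "\<lambda>n. 67/24 * fact n - fact (n - 2) :: real"
  let ?b = "\<lambda>n. 11/4 * fact (n - 2) :: real"
  have "K4_K3_step K4_K3_majorant s t
      = (real (m + 3) * ?a (m + 2) + real s * (real (m + 2) - 1) * ?b (m + 2)) / 2 ^ s"
    using K4_K3_step_affine[of s t "m + 2" ?a ?b] n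
    by (simp add: K4_K3_majorant_def[abs_def])
  moreover have "K4_K3_majorant s t = (?a (m + 3) + real s * ?b (m + 3)) / 2 ^ s"
    unfolding K4_K3_majorant_def n by simp
  ultimately have "K4_K3_majorant s t - K4_K3_step K4_K3_majorant s t = 2 * fact m / 2 ^ s"
    by (simp add: numeral_3_eq_3 field_simps)
  moreover have "(2::real) ^ s \<le> 2 * fact m"
    using power_increasing[OF \<open>s \<le> m\<close>, of "2::real"] two_power_le_two_mult_fact[of m]
    by (rule order_trans) simp
  then have "1 \<le> 2 * fact m / (2::real) ^ s"
    by simp
  ultimately show ?thesis
    by linarith
qed

lemma K4_K3_bound_le_majorant:
  assumes "4 \<le> 2 * s + t"
  shows "real (K4_K3_bound s t) \<le> K4_K3_majorant s t"
  using assms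
proof (induction "2 * s + t" arbitrary: s t rule: less_induct)
  case less
  show ?case
  proof (cases "2 * s + t = 4")
    case True
    then consider "s = 0" "t = 4" | "s = 1" "t = 2" | "s = 2" "t = 0"
      by (cases s; cases "s - 1") auto
    moreover have "K4_K3_bound 0 4 = 65" "K4_K3_bound 1 2 = 35" "K4_K3_bound 2 0 = 19"
      by (simp_all add: K4_K3_bound.simps)
    ultimately show ?thesis
      by cases (simp_all add: K4_K3_majorant_def fact_numeral)
  next
    case False
    have "real (K4_K3_bound s t) = 1 + K4_K3_step (\<lambda>s t. real (K4_K3_bound s t)) s t"
      by (simp add: K4_K3_bound_rec[of s t] K4_K3_step_def)
    also have "\<dots> \<le> 1 + K4_K3_step K4_K3_majorant s t"
      using less False by (intro add_left_mono K4_K3_step_mono) auto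
    also have "\<dots> \<le> K4_K3_majorant s t"
      using less.prems False by (intro K4_K3_majorant_step_le) simp
    finally show ?thesis .
  qed
qed

lemma three_mult_le_fact_double_div:
  assumes "2 \<le> r"
  shows "3 * real r \<le> fact (2 * r) / 2 ^ r"
  using assms
proof (induction r rule: nat_induct_at_least)
  case base
  show ?case by (simp add: fact_numeral)
next
  case (Suc r)
  have "1 \<le> fact (2 * r) / (2::real) ^ r"
    using Suc by linarith
  then have "3 * real (Suc r) * 1 \<le> (2 * real r + 1) * real (Suc r) * (fact (2 * r) / 2 ^ r)"
    using Suc.hyps by (intro mult_mono) auto
  also have "\<dots> = fact (2 * Suc r) / 2 ^ Suc r"
    by (simp add: field_simps)
  finally show ?case by simp
qed

definition ramsey_4_factor :: "nat \<Rightarrow> real" where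
  "ramsey_4_factor r =
     67/24 + (11/4 * real r - 1) / (2 * real r * (2 * real r - 1)) + 1 / (3 * real r)"

lemma diagonal_ramsey_4_le:
  assumes "2 \<le> r"
  shows "real (diagonal_ramsey r 4) \<le> fact (2 * r) / 2 ^ r * ramsey_4_factor r"
    (is "_ \<le> ?w * _")
proof -
  have fact_eq: "fact (2 * r) = 2 * real r * (2 * real r - 1) * fact (2 * r - 2)"
    using assms fact_reduce[where 'a = real, of "2 * r"] fact_reduce[where 'a = real, of "2 * r - 1"]
    by (simp flip: numeral_2_eq_2)
  have "real (diagonal_ramsey r 4) \<le> real (K4_K3_bound r 0) + 1"
    using of_nat_mono[OF diagonal_ramsey_4_le_K4_K3_bound[of r], where 'a = real] by simp
  also have "\<dots> \<le> K4_K3_majorant r 0 + ?w * (1 / (3 * real r))"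
  proof (rule add_mono)
    show "real (K4_K3_bound r 0) \<le> K4_K3_majorant r 0"
      using assms by (intro K4_K3_bound_le_majorant) simp
    show "1 \<le> ?w * (1 / (3 * real r))"
      using three_mult_le_fact_double_div[OF assms] assms by (simp add: field_simps)
  qed
  also have "K4_K3_majorant r 0
      = ?w * (67/24 + (11/4 * real r - 1) / (2 * real r * (2 * real r - 1)))"
    unfolding K4_K3_majorant_def add_0_right fact_eq using assms by (simp add: field_simps)
  finally show ?thesis
    by (simp add: ramsey_4_factor_def distrib_left)
qed

lemma ramsey_4_factor_le_explicit:
  assumes "2 \<le> r"
  shows "ramsey_4_factor r \<le> 10/3 - 2 * (real r - 2) / ((2 * real r - 1) * (2 * real r - 3))"
    (is "_ \<le> ?rhs")
proof -
  have "0 \<le> (real r - 2) * (real r - 3)"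
    using assms by (cases "r = 2") auto
  then have "0 \<le> 52 * real r * ((real r - 2) * (real r - 3)) + (real r - 2) * (10 * real r + 30)"
    using assms by simp
  then have "0 \<le> (52 * real r * ((real r - 2) * (real r - 3)) + (real r - 2) * (10 * real r + 30))
      / (24 * real r * (2 * real r - 1) * (2 * real r - 3))"
    using assms by (intro divide_nonneg_nonneg) auto
  also have "\<dots> = ?rhs - ramsey_4_factor r"
    using assms unfolding ramsey_4_factor_def by (simp add: divide_simps) (simp add: algebra_simps)
  finally show ?thesis by simp
qed

lemma ramsey_4_factor_le_asymptotic:
  assumes "2 \<le> r"
  shows "ramsey_4_factor r \<le> (3 + exp 1) / 2 * (1 + 1 / real r)"
proof -
  have "(11/4 * real r - 1) / (2 * real r * (2 * real r - 1)) \<le> 1 / real r"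
    using assms by (simp add: field_simps)
  then have "ramsey_4_factor r \<le> 67/24 * (1 + 1 / real r)"
    using assms by (simp add: ramsey_4_factor_def field_simps)
  also have "31/12 \<le> exp (1::real)"
    using exp_ge_one_plus_x_over_n_power_n[of 10 1] by (simp add: power_divide)
  then have "67/24 * (1 + 1 / real r) \<le> (3 + exp 1) / 2 * (1 + 1 / real r)"
    by (intro mult_right_mono) auto
  finally show ?thesis .
qed

theorem theorem1p3:
  shows "(\<forall>r::nat. r \<ge> 2 \<longrightarrow>
            real (diagonal_ramsey r 4) \<le>
              fact (2 * r) / 2 ^ r *
                (10 / 3 - 2 * (real r - 2) / ((2 * real r - 1) * (2 * real r - 3)))) \<and>
         (\<exists>\<epsilon> :: nat \<Rightarrow> real. \<epsilon> \<longlonglongrightarrow> 0 \<and>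
            (\<forall>r::nat. r \<ge> 2 \<longrightarrow>
              real (diagonal_ramsey r 4) \<le>
                fact (2 * r) / 2 ^ r * ((3 + exp 1) / 2) * (1 + \<epsilon> r)))"
proof (intro conjI exI[where x = "\<lambda>r. 1 / real r"] allI impI)
  show "(\<lambda>r. 1 / real r) \<longlonglongrightarrow> 0"
    by (rule lim_1_over_n)
next
  fix r :: nat assume r: "r \<ge> 2"
  show "real (diagonal_ramsey r 4) \<le> fact (2 * r) / 2 ^ r *
      (10 / 3 - 2 * (real r - 2) / ((2 * real r - 1) * (2 * real r - 3)))"
    using ramsey_4_factor_le_explicit[OF r]
    by (intro order_trans[OF diagonal_ramsey_4_le[OF r]] mult_left_mono) auto
  show "real (diagonal_ramsey r 4) \<le>
      fact (2 * r) / 2 ^ r * ((3 + exp 1) / 2) * (1 + 1 / real r)"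
    unfolding mult.assoc using ramsey_4_factor_le_asymptotic[OF r]
    by (intro order_trans[OF diagonal_ramsey_4_le[OF r]] mult_left_mono) auto
qed

end
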